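(* Suppose that $f\in C^2_p(\mathbb{R})$ satisfies $\lim_{|x|\to\infty}f(x)=+\infty$ and that $f$ is strictly convex. Let $(\mu(t),\sigma(t))$, $t\ge0$, solve the gradient flow $$\dot\mu=-\frac{\partial F}{\partial\mu}(\mu,\sigma),\qquad \dot\sigma=-\frac{\partial F}{\partial\sigma}(\mu,\sigma).$$ Then $\sigma(t)\to0$ as $t\to\infty$. Moreover, if $f$ is uniformly convex, then $\sigma(t)\to0$ exponentially.
   Context: $C^k_p(\mathbb{R})$ is the set of functions $f:\mathbb{R}\to\mathbb{R}$ with $k$ continuous derivatives such that for every $0\le j\le k$, $\lim_{|x|\to\infty}f^{(j)}(x)/|x|^m=0$ for some $m>0$. A $C^2$ function $f$ is called strictly convex if $f''(x)>0$ for all $x$, and uniformly convex if there is $\tau>0$ with $f''(x)\ge\tau$ for all $x$. For $\mu\in\mathbb{R}$, $\sigma>0$, $\Gamma_{\mu,\sigma}(x)=\frac{1}{\sqrt{2\pi}\,\sigma}e^{-(x-\mu)^2/(2\sigma^2)}$ and $F(\mu,\sigma)=\int_{\mathbb{R}}f(x)\Gamma_{\mu,\sigma}(x)\,dx$. For $f\in C^2_p(\mathbb{R})$, $F$ and $\nabla F$ extend continuously to $\sigma=0$, and the flow is considered on $\{\sigma\ge0\}$. *)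

theory Defs
  imports "HOL-Probability.Probability"
begin

definition Ck :: "nat \<Rightarrow> (real \<Rightarrow> real) \<Rightarrow> bool" where
  "Ck k f \<longleftrightarrow>
     (\<forall>j<k. \<forall>x. ((deriv ^^ j) f) differentiable (at x)) \<and>
     (\<forall>j\<le>k. continuous_on UNIV ((deriv ^^ j) f))"

definition Ckp :: "nat \<Rightarrow> (real \<Rightarrow> real) \<Rightarrow> bool" where
  "Ckp k f \<longleftrightarrow> Ck k f \<and>
     (\<forall>j\<le>k. \<exists>m::real. m > 0 \<and>
        ((\<lambda>x. (deriv ^^ j) f x / \<bar>x\<bar> powr m) \<longlongrightarrow> 0) at_infinity)"

text \<open>The next two notions are only meant for \<^term>\<open>f\<close> with \<^term>\<open>Ck 2 f\<close>.\<close>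

definition strictly_convex :: "(real \<Rightarrow> real) \<Rightarrow> bool" where
  "strictly_convex f \<longleftrightarrow> (\<forall>x. (deriv ^^ 2) f x > 0)"

definition uniformly_convex :: "(real \<Rightarrow> real) \<Rightarrow> bool" where
  "uniformly_convex f \<longleftrightarrow> (\<exists>\<tau>>0. \<forall>x. (deriv ^^ 2) f x \<ge> \<tau>)"

text \<open>The Gaussian average of \<^term>\<open>f\<close>. It has the intended meaning only for
  \<^term>\<open>\<sigma> > 0\<close>, where \<^term>\<open>normal_density \<mu> \<sigma>\<close> is the usual Gaussian
  density with mean \<^term>\<open>\<mu>\<close> and standard deviation \<^term>\<open>\<sigma>\<close>.\<close>

definition gauss_avg :: "(real \<Rightarrow> real) \<Rightarrow> real \<Rightarrow> real \<Rightarrow> real" where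
  "gauss_avg f \<mu> \<sigma> = (LBINT x. f x * normal_density \<mu> \<sigma> x)"

lemma normal_density_eq:
  assumes "\<sigma> > 0"
  shows "normal_density \<mu> \<sigma> x =
    1 / (sqrt (2 * pi) * \<sigma>) * exp (- (x - \<mu>)\<^sup>2 / (2 * \<sigma>\<^sup>2))"
  using assms by (simp add: normal_density_def real_sqrt_mult)

text \<open>Continuous extension to the closed half plane of a function given on the
  open half plane of points with positive second coordinate.\<close>

definition half_plane_ext :: "(real \<Rightarrow> real \<Rightarrow> real) \<Rightarrow> real \<Rightarrow> real \<Rightarrow> real" where
  "half_plane_ext G \<mu> \<sigma> =
     (if \<sigma> > 0 then G \<mu> \<sigma>
      else Lim (at (\<mu>, \<sigma>) within (UNIV \<times> {0<..})) (\<lambda>(m, s). G m s))"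

definition dF_mu :: "(real \<Rightarrow> real) \<Rightarrow> real \<Rightarrow> real \<Rightarrow> real" where
  "dF_mu f = half_plane_ext (\<lambda>\<mu> \<sigma>. deriv (\<lambda>m. gauss_avg f m \<sigma>) \<mu>)"

definition dF_sigma :: "(real \<Rightarrow> real) \<Rightarrow> real \<Rightarrow> real \<Rightarrow> real" where
  "dF_sigma f = half_plane_ext (\<lambda>\<mu> \<sigma>. deriv (\<lambda>s. gauss_avg f \<mu> s) \<sigma>)"

definition gradient_flow ::
    "(real \<Rightarrow> real) \<Rightarrow> (real \<Rightarrow> real) \<Rightarrow> (real \<Rightarrow> real) \<Rightarrow> bool" where
  "gradient_flow f \<mu> \<sigma> \<longleftrightarrow>
     (\<forall>t\<ge>0. \<sigma> t \<ge> 0 \<and>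
        (\<mu> has_real_derivative - dF_mu f (\<mu> t) (\<sigma> t)) (at t within {0..}) \<and>
        (\<sigma> has_real_derivative - dF_sigma f (\<mu> t) (\<sigma> t)) (at t within {0..}))"

definition tends_to_zero_exponentially :: "(real \<Rightarrow> real) \<Rightarrow> bool" where
  "tends_to_zero_exponentially g \<longleftrightarrow>
     (\<exists>C>0. \<exists>c>0. \<forall>t\<ge>0. \<bar>g t\<bar> \<le> C * exp (- c * t))"

end

theory Submission
  imports Defs
begin

text \<open>
  Writing \<open>X = \<mu> + \<sigma> Z\<close> with \<open>Z\<close> standard normal, differentiation under the integral sign gives
  \<open>\<partial>F/\<partial>\<mu> = E f'(X)\<close> and \<open>\<partial>F/\<partial>\<sigma> = E (Z f'(X)) = E (Z (f'(X) - f'(\<mu>)))\<close>.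
  The latter is nonnegative since \<open>f'\<close> is increasing, so \<open>\<sigma>\<close> is nonincreasing, and it is at least
  \<open>\<tau> \<sigma>\<close> when \<open>f'' \<ge> \<tau>\<close>, which gives the exponential rate. If \<open>x\<^sub>0\<close> is the minimiser of \<open>f\<close>, then
  \<open>(\<mu> - x\<^sub>0)\<^sup>2 + \<sigma>\<^sup>2\<close> has derivative \<open>-2 E ((X - x\<^sub>0) f'(X)) \<le> 0\<close> along the flow, so trajectories are
  bounded. Hence if \<open>\<sigma>\<close> stayed above some \<open>L > 0\<close>, then \<open>f''\<close> would be bounded below on the relevant
  compact interval, \<open>\<partial>F/\<partial>\<sigma>\<close> would stay above a positive constant, and \<open>\<sigma>\<close> would become negative.
\<close>

section \<open>Gaussian integrals of functions of polynomial growth\<close>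

lemma integrable_std_normal_growth:
  "integrable lborel (\<lambda>z. std_normal_density z * (1 + \<bar>z\<bar>) ^ n)"
proof -
  have "(\<lambda>z. std_normal_density z * (1 + \<bar>z\<bar>) ^ n) =
        (\<lambda>z. \<Sum>k\<le>n. of_nat (n choose k) * (std_normal_density z * \<bar>z\<bar> ^ (n - k)))"
    by (simp add: binomial_ring sum_distrib_left mult_ac)
  then show ?thesis
    by (simp add: integrable_std_normal_moment_abs del: of_nat_mult)
qed

text \<open>The majorant sees the coefficients of the affine arguments only through
  \<open>K\<close>, so one function of \<open>z\<close> dominates a whole bounded family of
  integrands. This serves both integrability and dominated convergence.\<close>

lemma growth_affine_bound:
  fixes g :: "real \<Rightarrow> real"
  assumes growth: "\<And>x. \<bar>g x\<bar> \<le> C * (1 + \<bar>x\<bar>) ^ k"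
    and x: "\<bar>x\<bar> \<le> K * (1 + \<bar>z\<bar>)" and K: "K \<ge> 1" and y: "\<bar>y\<bar> \<le> K * (1 + \<bar>z\<bar>)"
  shows "\<bar>y * g x\<bar> \<le> (K * C * (2 * K) ^ k) * (1 + \<bar>z\<bar>) ^ Suc k"
proof -
  have C: "C \<ge> 0" using growth[of 0] by auto
  have "1 \<le> K * (1 + \<bar>z\<bar>)" using mult_mono[of 1 K 1 "1 + \<bar>z\<bar>"] K by simp
  then have "1 + \<bar>x\<bar> \<le> (2 * K) * (1 + \<bar>z\<bar>)" using x by (simp add: algebra_simps)
  then have "(1 + \<bar>x\<bar>) ^ k \<le> ((2 * K) * (1 + \<bar>z\<bar>)) ^ k" by (intro power_mono) auto
  then have "\<bar>g x\<bar> \<le> C * ((2 * K) * (1 + \<bar>z\<bar>)) ^ k"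
    using growth[of x] mult_left_mono[OF _ C] by (meson order_trans)
  then have "\<bar>y\<bar> * \<bar>g x\<bar> \<le> (K * (1 + \<bar>z\<bar>)) * (C * ((2 * K) * (1 + \<bar>z\<bar>)) ^ k)"
    using K y by (intro mult_mono) auto
  then show ?thesis
    unfolding power_mult_distrib[of "2 * K"] abs_mult power_Suc by (simp only: mult_ac)
qed

lemma abs_affine_le:
  fixes a b z :: real
  assumes "\<bar>a\<bar> \<le> K" "\<bar>b\<bar> \<le> K"
  shows "\<bar>a + b * z\<bar> \<le> K * (1 + \<bar>z\<bar>)"
proof -
  have "\<bar>b * z\<bar> \<le> K * \<bar>z\<bar>" using assms(2) by (simp add: abs_mult mult_right_mono)
  then show ?thesis using assms(1) by (simp add: algebra_simps)
qed

lemma integrable_std_normal_affine: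
  fixes g :: "real \<Rightarrow> real"
  assumes growth: "\<And>x. \<bar>g x\<bar> \<le> C * (1 + \<bar>x\<bar>) ^ k" and cont: "continuous_on UNIV g"
  shows "integrable lborel (\<lambda>z. std_normal_density z * ((c + d * z) * g (a + b * z)))"
proof -
  \<comment> \<open>One constant above all four coefficients; the summand 1 secures
    \<open>K \<ge> 1\<close>.\<close>
  define K where "K = 1 + \<bar>a\<bar> + \<bar>b\<bar> + \<bar>c\<bar> + \<bar>d\<bar>"
  define D where "D = K * C * (2 * K) ^ k"
  have [measurable]: "g \<in> borel_measurable borel"
    using cont by (rule borel_measurable_continuous_onI)
  have poly: "\<bar>(c + d * z) * g (a + b * z)\<bar> \<le> D * (1 + \<bar>z\<bar>) ^ Suc k" for z
    unfolding D_def
    by (intro growth_affine_bound[OF growth] abs_affine_le) (auto simp: K_def)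
  then have bound: "\<bar>std_normal_density z * ((c + d * z) * g (a + b * z))\<bar> \<le>
      D * (std_normal_density z * (1 + \<bar>z\<bar>) ^ Suc k)" for z
    using mult_left_mono[OF poly[of z], of "std_normal_density z"]
    by (simp add: abs_mult mult.left_commute)
  show ?thesis
  proof (rule Bochner_Integration.integrable_bound)
    show "integrable lborel (\<lambda>z. D * (std_normal_density z * (1 + \<bar>z\<bar>) ^ Suc k))"
      by (intro integrable_mult_right integrable_std_normal_growth)
    show "AE z in lborel. norm (std_normal_density z * ((c + d * z) * g (a + b * z))) \<le>
      norm (D * (std_normal_density z * (1 + \<bar>z\<bar>) ^ Suc k))"
      using bound by (intro AE_I2) (smt (verit) real_norm_def)
  qed measurable
qed

text \<open>This is a directional derivative in the parameters \<open>(a, b)\<close> along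
  \<open>(c, d)\<close>: direction (1, 0) yields the partial derivative in \<mu>, direction (0, 1)
  the one in \<sigma>. Dominated convergence applies to the difference quotients.\<close>

lemma has_derivative_std_normal_affine:
  fixes g g' :: "real \<Rightarrow> real"
  assumes der: "\<And>x. (g has_real_derivative g' x) (at x)"
    and growth: "\<And>x. \<bar>g x\<bar> \<le> C * (1 + \<bar>x\<bar>) ^ k"
    and growth': "\<And>x. \<bar>g' x\<bar> \<le> C' * (1 + \<bar>x\<bar>) ^ k'"
    and cont': "continuous_on UNIV g'"
  shows "((\<lambda>h. \<integral>z. std_normal_density z * g ((a + h * c) + (b + h * d) * z) \<partial>lborel)
    has_real_derivative (\<integral>z. std_normal_density z * ((c + d * z) * g' (a + b * z)) \<partial>lborel)) (at 0)"
proof -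
  have cont: "continuous_on UNIV g"
    using der by (meson DERIV_isCont continuous_at_imp_continuous_on)
  have [measurable]: "g \<in> borel_measurable borel" "g' \<in> borel_measurable borel"
    using cont cont' by (auto intro: borel_measurable_continuous_onI)
  have int: "integrable lborel (\<lambda>z. std_normal_density z * g (p + q * z))" for p q
    using integrable_std_normal_affine[OF growth cont, of 1 0 p q] by simp
  define G where "G = (\<lambda>h z. g ((a + h * c) + (b + h * d) * z))"
  define D where "D = (\<lambda>z. (c + d * z) * g' (a + b * z))"
  have ptw: "((\<lambda>h. G h z) has_real_derivative (c + d * z) * g' ((a + h * c) + (b + h * d) * z)) (at h)"
    for h z
  proof -
    have "((\<lambda>h. (a + h * c) + (b + h * d) * z) has_real_derivative c + d * z) (at h)"
      by (auto intro!: derivative_eq_intros)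
    from DERIV_chain2[OF der this] show ?thesis
      unfolding G_def by (simp only: mult.commute)
  qed
  \<comment> \<open>Dominated convergence is used for sequences, so the limit h to 0 is tested along
    an arbitrary null sequence \<open>S\<close> of nonzero increments.\<close>
  have "(\<lambda>n. ((\<integral>z. std_normal_density z * G (0 + S n) z \<partial>lborel) -
        (\<integral>z. std_normal_density z * G 0 z \<partial>lborel)) / S n)
      \<longlonglongrightarrow> (\<integral>z. std_normal_density z * D z \<partial>lborel)"
    if nz: "\<And>n. S n \<noteq> 0" and S: "S \<longlonglongrightarrow> 0" for S :: "nat \<Rightarrow> real"
  proof -
    \<comment> \<open>A null sequence is bounded, so every intermediate parameter
      \<open>a + \<theta> * c\<close> and \<open>b + \<theta> * d\<close> with
      \<open>\<bar>\<theta>\<bar> \<le> B\<close> stays below a \<open>K\<close> independent of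
      \<open>n\<close> and \<open>z\<close>.\<close>
    obtain B where B: "B > 0" "\<And>n. \<bar>S n\<bar> \<le> B"
      using S convergent_imp_Bseq[of S] by (auto simp: convergent_def Bseq_def)
    define P where "P = \<bar>a\<bar> + B * \<bar>c\<bar>"
    define Q where "Q = \<bar>b\<bar> + B * \<bar>d\<bar>"
    define N where "N = \<bar>c\<bar> + \<bar>d\<bar>"
    define K where "K = 1 + P + Q + N"
    have "P \<ge> 0" "Q \<ge> 0" "N \<ge> 0" using B(1) by (auto simp: P_def Q_def N_def)
    then have K: "P \<le> K" "Q \<le> K" "N \<le> K" "1 \<le> K" by (simp_all add: K_def)
    moreover have "\<bar>c\<bar> \<le> N" "\<bar>d\<bar> \<le> N" by (simp_all add: N_def)
    ultimately have cd: "\<bar>c\<bar> \<le> K" "\<bar>d\<bar> \<le> K" by (blast intro: order_trans)+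
    define M where "M = K * C' * (2 * K) ^ k'"
    have quot: "\<bar>(G (S n) z - G 0 z) / S n\<bar> \<le> M * (1 + \<bar>z\<bar>) ^ Suc k'" for n z
    proof -
      \<comment> \<open>The mean value theorem needs ordered endpoints, hence the split on the sign
        of \<open>S n\<close>. The point \<theta> depends on \<open>n\<close> and \<open>z\<close>,
        but its bound \<open>B\<close> does not.\<close>
      obtain \<theta> where \<theta>: "\<bar>\<theta>\<bar> \<le> B"
        "G (S n) z - G 0 z = S n * ((c + d * z) * g' ((a + \<theta> * c) + (b + \<theta> * d) * z))"
      proof (cases "S n > 0")
        case True
        then obtain x where "0 < x" "x < S n"
          "G (S n) z - G 0 z = (S n - 0) * ((c + d * z) * g' ((a + x * c) + (b + x * d) * z))"
          using MVT2[of 0 "S n" "\<lambda>h. G h z", OF _ ptw] by blast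
        then show ?thesis using B(2)[of n] by (intro that[of x]) auto
      next
        case False
        then have "S n < 0" using nz[of n] by auto
        then obtain x where "S n < x" "x < 0"
          "G 0 z - G (S n) z = (0 - S n) * ((c + d * z) * g' ((a + x * c) + (b + x * d) * z))"
          using MVT2[of "S n" 0 "\<lambda>h. G h z", OF _ ptw] by blast
        then show ?thesis using B(2)[of n] by (intro that[of x]) auto
      qed
      have "\<bar>\<theta> * c\<bar> \<le> B * \<bar>c\<bar>" "\<bar>\<theta> * d\<bar> \<le> B * \<bar>d\<bar>"
        using \<theta>(1) by (auto simp: abs_mult mult_right_mono)
      then have "\<bar>a + \<theta> * c\<bar> \<le> P" "\<bar>b + \<theta> * d\<bar> \<le> Q"
        unfolding P_def Q_def by (blast intro: order_trans[OF abs_triangle_ineq] add_left_mono)+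
      then have ab: "\<bar>a + \<theta> * c\<bar> \<le> K" "\<bar>b + \<theta> * d\<bar> \<le> K"
        using K by (blast intro: order_trans)+
      have "\<bar>(c + d * z) * g' ((a + \<theta> * c) + (b + \<theta> * d) * z)\<bar> \<le> M * (1 + \<bar>z\<bar>) ^ Suc k'"
        unfolding M_def by (intro growth_affine_bound[OF growth'] abs_affine_le ab cd K)
      then show ?thesis using \<theta>(2) nz[of n] by simp
    qed
    have "(\<lambda>n. \<integral>z. std_normal_density z * ((G (S n) z - G 0 z) / S n) \<partial>lborel)
        \<longlonglongrightarrow> (\<integral>z. std_normal_density z * D z \<partial>lborel)"
    proof (rule integral_dominated_convergence)
      show "integrable lborel (\<lambda>z. M * (std_normal_density z * (1 + \<bar>z\<bar>) ^ Suc k'))"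
        by (intro integrable_mult_right integrable_std_normal_growth)
      show "AE z in lborel. norm (std_normal_density z * ((G (S n) z - G 0 z) / S n)) \<le>
          M * (std_normal_density z * (1 + \<bar>z\<bar>) ^ Suc k')" for n
      proof (rule AE_I2)
        fix z :: real
        show "norm (std_normal_density z * ((G (S n) z - G 0 z) / S n)) \<le>
          M * (std_normal_density z * (1 + \<bar>z\<bar>) ^ Suc k')"
          using mult_left_mono[OF quot[where n=n and z=z], of "std_normal_density z"]
          by (simp add: abs_mult mult.left_commute)
      qed
      show "AE z in lborel. (\<lambda>n. std_normal_density z * ((G (S n) z - G 0 z) / S n))
          \<longlonglongrightarrow> std_normal_density z * D z"
      proof (intro AE_I2 tendsto_mult_left)
        fix z :: real
        have "((\<lambda>h. (G (0 + h) z - G 0 z) / h) \<longlongrightarrow> D z) (at 0)"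
          using ptw[where h=0 and z=z] unfolding DERIV_def by (simp add: D_def)
        moreover have "filterlim S (at 0) sequentially"
          using S nz by (simp add: filterlim_at)
        ultimately show "(\<lambda>n. (G (S n) z - G 0 z) / S n) \<longlonglongrightarrow> D z"
          using filterlim_compose by fastforce
      qed
    qed (unfold G_def D_def, measurable)
    moreover have "(\<integral>z. std_normal_density z * ((G (S n) z - G 0 z) / S n) \<partial>lborel) =
        ((\<integral>z. std_normal_density z * G (0 + S n) z \<partial>lborel) -
        (\<integral>z. std_normal_density z * G 0 z \<partial>lborel)) / S n" for n
    proof -
      have "(\<integral>z. std_normal_density z * ((G (S n) z - G 0 z) / S n) \<partial>lborel) =
          (\<integral>z. (std_normal_density z * G (S n) z - std_normal_density z * G 0 z) / S n \<partial>lborel)"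
        by (simp only: right_diff_distrib times_divide_eq_right)
      also have "\<dots> = (\<integral>z. std_normal_density z * G (S n) z - std_normal_density z * G 0 z \<partial>lborel) / S n"
        by (rule Bochner_Integration.integral_divide_zero)
      also have "\<dots> = ((\<integral>z. std_normal_density z * G (S n) z \<partial>lborel) -
          (\<integral>z. std_normal_density z * G 0 z \<partial>lborel)) / S n"
        unfolding G_def using int by (subst Bochner_Integration.integral_diff) auto
      finally show ?thesis by simp
    qed
    ultimately show ?thesis by (simp only:)
  qed
  then show ?thesis
    unfolding DERIV_def G_def D_def LIMSEQ_SEQ_conv[symmetric] by simp
qed

text \<open>The substitution x = m + s z moves the parameters from the density into the argument of
  \<open>f\<close>, so that differentiating in them only produces \<open>f'\<close>.\<close>

lemma gauss_avg_std_normal: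
  assumes "s > 0"
  shows "gauss_avg f m s = (\<integral>z. std_normal_density z * f (m + s * z) \<partial>lborel)"
proof -
  have dens: "normal_density m s (m + s * z) = std_normal_density z / s" for z
    using assms by (simp add: normal_density_def real_sqrt_mult field_simps power_mult_distrib)
  have "gauss_avg f m s = (\<integral>x. f x * normal_density m s x \<partial>lborel)"
    by (simp add: gauss_avg_def set_lebesgue_integral_def)
  also have "\<dots> = s * (\<integral>z. f (m + s * z) * normal_density m s (m + s * z) \<partial>lborel)"
    using assms by (subst lborel_integral_real_affine[of s _ m]) simp_all
  also have "\<dots> = (\<integral>z. s * (f (m + s * z) * normal_density m s (m + s * z)) \<partial>lborel)"
    by (rule Bochner_Integration.integral_mult_right_zero[symmetric])
  also have "\<dots> = (\<integral>z. std_normal_density z * f (m + s * z) \<partial>lborel)"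
    using assms by (intro Bochner_Integration.integral_cong) (simp_all add: dens)
  finally show ?thesis .
qed

section \<open>Global growth bounds and existence of a critical point\<close>

lemma continuous_imp_polynomial_growth:
  fixes g :: "real \<Rightarrow> real"
  assumes lim: "((\<lambda>x. g x / \<bar>x\<bar> powr m) \<longlongrightarrow> 0) at_infinity"
    and cont: "continuous_on UNIV g"
  shows "\<exists>C k. \<forall>x. \<bar>g x\<bar> \<le> C * (1 + \<bar>x\<bar>) ^ k"
proof -
  have "eventually (\<lambda>x. \<bar>g x / \<bar>x\<bar> powr m\<bar> < 1) at_infinity"
    using tendstoD[OF lim, of 1] by simp
  then obtain b where b: "\<And>x. b \<le> \<bar>x\<bar> \<Longrightarrow> \<bar>g x / \<bar>x\<bar> powr m\<bar> < 1"
    by (auto simp: eventually_at_infinity)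
  \<comment> \<open>Beyond \<open>R\<close> the limit gives
    \<open>\<bar>g x\<bar> \<le> \<bar>x\<bar> powr m\<close>, and \<open>R \<ge> 1\<close> allows
    raising the exponent to the natural number \<open>k\<close>. Inside, compactness bounds
    \<open>g\<close>.\<close>
  define R where "R = max b 1"
  define k where "k = nat \<lceil>m\<rceil>"
  have "bounded (g ` {-R..R})"
    using cont by (intro compact_imp_bounded compact_continuous_image) (auto intro: continuous_on_subset)
  then obtain C where C: "\<forall>x\<in>{-R..R}. \<bar>g x\<bar> \<le> C"
    by (auto simp: bounded_iff)
  have "\<bar>g x\<bar> \<le> (\<bar>C\<bar> + 1) * (1 + \<bar>x\<bar>) ^ k" for x
  proof (cases "\<bar>x\<bar> \<le> R")
    case True
    then have "\<bar>g x\<bar> \<le> (\<bar>C\<bar> + 1) * 1" using C[rule_format, of x] by (auto simp: abs_le_iff)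
    also have "\<dots> \<le> (\<bar>C\<bar> + 1) * (1 + \<bar>x\<bar>) ^ k"
      by (intro mult_left_mono one_le_power) auto
    finally show ?thesis .
  next
    case False
    then have x: "\<bar>x\<bar> \<ge> 1" "b \<le> \<bar>x\<bar>" by (auto simp: R_def)
    have "\<bar>g x\<bar> \<le> \<bar>x\<bar> powr m" using b[OF x(2)] x(1) by (simp add: abs_divide)
    also have "\<dots> \<le> \<bar>x\<bar> powr real k"
      using x(1) by (intro powr_mono) (auto simp: k_def real_nat_ceiling_ge)
    also have "\<dots> = \<bar>x\<bar> ^ k" using x(1) by (intro powr_realpow) auto
    also have "\<dots> \<le> 1 * (1 + \<bar>x\<bar>) ^ k" by (simp add: power_mono)
    also have "\<dots> \<le> (\<bar>C\<bar> + 1) * (1 + \<bar>x\<bar>) ^ k" by (intro mult_right_mono) auto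
    finally show ?thesis .
  qed
  then show ?thesis by blast
qed

lemma exists_deriv_zero:
  fixes f :: "real \<Rightarrow> real"
  assumes lim: "filterlim f at_top at_infinity"
    and der: "\<And>x. (f has_real_derivative f' x) (at x)"
  shows "\<exists>x. f' x = 0"
proof -
  obtain b where b: "\<And>x. b \<le> \<bar>x\<bar> \<Longrightarrow> f 0 \<le> f x"
    using lim by (auto simp: filterlim_at_top eventually_at_infinity)
  \<comment> \<open>Using \<open>\<bar>b\<bar>\<close> puts 0 in the interval whatever the sign of
    \<open>b\<close>. The minimum there is at most \<open>f 0\<close>, which bounds \<open>f\<close>
    from below outside, so it is global.\<close>
  have "continuous_on {-\<bar>b\<bar>..\<bar>b\<bar>} f"
    using der by (meson DERIV_isCont continuous_at_imp_continuous_on)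
  then obtain x where x: "\<forall>y\<in>{-\<bar>b\<bar>..\<bar>b\<bar>}. f x \<le> f y"
    using continuous_attains_inf[of "{-\<bar>b\<bar>..\<bar>b\<bar>}" f] by fastforce
  have "f x \<le> f y" for y
  proof (cases "\<bar>y\<bar> \<le> \<bar>b\<bar>")
    case True
    then show ?thesis using x by (auto simp: abs_le_iff)
  next
    case False
    then show ?thesis using b[of y] x[rule_format, of 0] by fastforce
  qed
  then show ?thesis using DERIV_local_min[OF der[of x], of 1] by auto
qed

section \<open>The gradient of the Gaussian average of a convex function\<close>

locale convex_potential =
  fixes f f' f'' :: "real \<Rightarrow> real" and C C' :: real and k k' :: nat
  assumes der: "\<And>x. (f has_real_derivative f' x) (at x)"
    and der': "\<And>x. (f' has_real_derivative f'' x) (at x)"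
    and growth: "\<And>x. \<bar>f x\<bar> \<le> C * (1 + \<bar>x\<bar>) ^ k"
    and growth': "\<And>x. \<bar>f' x\<bar> \<le> C' * (1 + \<bar>x\<bar>) ^ k'"
    and convex: "\<And>x. f'' x > 0"
begin

abbreviation grad_mu :: "real \<Rightarrow> real \<Rightarrow> real" where
  "grad_mu m s \<equiv> (\<integral>z. std_normal_density z * f' (m + s * z) \<partial>lborel)"

abbreviation grad_sigma :: "real \<Rightarrow> real \<Rightarrow> real" where
  "grad_sigma m s \<equiv> (\<integral>z. std_normal_density z * (z * f' (m + s * z)) \<partial>lborel)"

lemma cont_f': "continuous_on UNIV f'"
  using der' by (meson DERIV_isCont continuous_at_imp_continuous_on)

lemma dF_mu_eq:
  assumes "s > 0"
  shows "dF_mu f m s = grad_mu m s"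
proof -
  have "((\<lambda>h. gauss_avg f (m + h) s) has_real_derivative grad_mu m s) (at 0)"
    using has_derivative_std_normal_affine[OF der growth growth' cont_f', of m 1 s 0] assms
    by (simp add: gauss_avg_std_normal)
  then have "((\<lambda>x. gauss_avg f x s) has_real_derivative grad_mu m s) (at m)"
    using DERIV_at_within_shift[of "\<lambda>x. gauss_avg f x s" "grad_mu m s" m 0 UNIV] by simp
  then show ?thesis
    using assms by (simp add: dF_mu_def half_plane_ext_def DERIV_imp_deriv)
qed

lemma dF_sigma_eq:
  assumes "s > 0"
  shows "dF_sigma f m s = grad_sigma m s"
proof -
  \<comment> \<open>The substitution formula requires \<open>s + h > 0\<close>, so the two functions
    of \<open>h\<close> are identified only near 0, which suffices for the derivative.\<close>
  have "eventually (\<lambda>h. h \<in> {-s<..}) (nhds 0)"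
    using assms by (intro eventually_nhds_in_open) auto
  then have ev: "eventually (\<lambda>h. (\<integral>z. std_normal_density z * f (m + (s + h) * z) \<partial>lborel) =
      gauss_avg f m (s + h)) (nhds 0)"
    by eventually_elim (simp add: gauss_avg_std_normal)
  have "((\<lambda>h. \<integral>z. std_normal_density z * f (m + (s + h) * z) \<partial>lborel)
      has_real_derivative grad_sigma m s) (at 0)"
    using has_derivative_std_normal_affine[OF der growth growth' cont_f', of m 0 s 1] by simp
  then have "((\<lambda>h. gauss_avg f m (s + h)) has_real_derivative grad_sigma m s) (at 0)"
    using DERIV_cong_ev[OF refl ev refl] by blast
  then have "((\<lambda>x. gauss_avg f m x) has_real_derivative grad_sigma m s) (at s)"
    using DERIV_at_within_shift[of "\<lambda>x. gauss_avg f m x" "grad_sigma m s" s 0 UNIV] by simp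
  then show ?thesis
    using assms by (simp add: dF_sigma_def half_plane_ext_def DERIV_imp_deriv)
qed

lemma f'_mono: "x \<le> y \<Longrightarrow> f' x \<le> f' y"
  using DERIV_nonneg_imp_nondecreasing[of x y f'] der' convex less_imp_le by metis

lemma increment_nonneg: "0 \<le> (x - y) * (f' x - f' y)"
  using f'_mono[of x y] f'_mono[of y x] by (cases "x \<le> y") (auto simp: mult_nonpos_nonpos)

text \<open>By the mean value theorem the increment of \<open>f'\<close> is \<open>f''\<close> at an
  intermediate point times the increment of the argument, and that point again lies in
  [-R, R].\<close>

lemma increment_ge:
  assumes "\<And>\<xi>. \<bar>\<xi>\<bar> \<le> R \<Longrightarrow> f'' \<xi> \<ge> c" "\<bar>x\<bar> \<le> R" "\<bar>y\<bar> \<le> R"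
  shows "(x - y) * (f' x - f' y) \<ge> c * (x - y)\<^sup>2"
proof -
  have *: "(v - u) * (f' v - f' u) \<ge> c * (v - u)\<^sup>2" if "u < v" "\<bar>u\<bar> \<le> R" "\<bar>v\<bar> \<le> R" for u v
  proof -
    obtain \<xi> where \<xi>: "u < \<xi>" "\<xi> < v" "f' v - f' u = (v - u) * f'' \<xi>"
      using MVT2[OF \<open>u < v\<close> der'] by blast
    then have "f'' \<xi> \<ge> c" using assms(1)[of \<xi>] that by auto
    then have "c * (v - u)\<^sup>2 \<le> f'' \<xi> * (v - u)\<^sup>2" by (simp add: mult_right_mono)
    then show ?thesis using \<xi>(3) by (simp add: power2_eq_square mult_ac)
  qed
  show ?thesis
    using *[of x y] *[of y x] assms(2,3)
    by (cases x y rule: linorder_cases) (auto simp: power2_commute[of x y] algebra_simps)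
qed

lemma integrable_affine_f':
  "integrable lborel (\<lambda>z. std_normal_density z * ((c + d * z) * f' (m + s * z)))"
  by (rule integrable_std_normal_affine[OF growth' cont_f'])

lemma integrable_increment:
  "integrable lborel (\<lambda>z. std_normal_density z * (z * (f' (m + s * z) - f' m)))"
proof -
  have "integrable lborel (\<lambda>z. std_normal_density z * (z * f' (m + s * z)) - std_normal_density z * (z * f' (m + 0 * z)))"
    using integrable_affine_f'[of 0 1 m s] integrable_affine_f'[of 0 1 m 0]
    by (intro Bochner_Integration.integrable_diff) simp_all
  then show ?thesis by (simp add: right_diff_distrib)
qed

text \<open>Subtracting \<open>f' m\<close> costs nothing because the standard normal has mean zero.\<close>

lemma grad_sigma_eq:
  "grad_sigma m s = (\<integral>z. std_normal_density z * (z * (f' (m + s * z) - f' m)) \<partial>lborel)"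
proof -
  have "(\<integral>z. std_normal_density z * (z * (f' (m + s * z) - f' m)) \<partial>lborel) =
      (\<integral>z. std_normal_density z * (z * f' (m + s * z)) - f' m * (std_normal_density z * z) \<partial>lborel)"
    by (rule Bochner_Integration.integral_cong) (simp_all add: algebra_simps)
  also have "\<dots> = grad_sigma m s - f' m * (\<integral>z. std_normal_density z * z \<partial>lborel)"
    using integrable_affine_f'[of 0 1 m s] integrable_std_normal_moment[of 1]
    by (subst Bochner_Integration.integral_diff) simp_all
  also have "(\<integral>z. std_normal_density z * z \<partial>lborel) = 0"
    using integral_std_normal_moment_odd[of 0] by simp
  finally show ?thesis by simp
qed

lemma scaled_increment_ge:
  assumes "\<And>\<xi>. \<bar>\<xi>\<bar> \<le> R \<Longrightarrow> f'' \<xi> \<ge> c" "s > 0" "\<bar>m + s * z\<bar> \<le> R" "\<bar>m\<bar> \<le> R"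
  shows "z * (f' (m + s * z) - f' m) \<ge> c * s * z\<^sup>2"
proof -
  have "s * (z * (f' (m + s * z) - f' m)) \<ge> s * (c * s * z\<^sup>2)"
    using increment_ge[of R c, OF assms(1,3,4)]
    by (simp add: algebra_simps power2_eq_square)
  then show ?thesis using assms(2) by simp
qed

lemma scaled_increment_nonneg:
  assumes "s > 0"
  shows "z * (f' (m + s * z) - f' m) \<ge> 0"
  using increment_nonneg[of "m + s * z" m] assms by (simp add: mult.assoc zero_le_mult_iff)

lemma grad_sigma_nonneg:
  assumes "s > 0"
  shows "grad_sigma m s \<ge> 0"
  unfolding grad_sigma_eq using scaled_increment_nonneg[OF assms] by simp

text \<open>The pointwise bound \<open>\<tau> * s * z\<^sup>2\<close> integrates to
  \<open>\<tau> * s\<close> because the standard normal has second moment 1.\<close>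

lemma grad_sigma_ge_uniform:
  assumes "\<And>x. f'' x \<ge> \<tau>" "s > 0"
  shows "grad_sigma m s \<ge> \<tau> * s"
proof -
  have "(\<integral>z. std_normal_density z * z\<^sup>2 \<partial>lborel) = 1"
    using integral_std_normal_moment_even[of 1] by simp
  moreover have "(\<integral>z. \<tau> * s * (std_normal_density z * z\<^sup>2) \<partial>lborel) \<le>
    (\<integral>z. std_normal_density z * (z * (f' (m + s * z) - f' m)) \<partial>lborel)"
  proof (rule integral_mono)
    show "integrable lborel (\<lambda>z. \<tau> * s * (std_normal_density z * z\<^sup>2))"
      by (intro integrable_mult_right integrable_std_normal_moment)
    show "\<tau> * s * (std_normal_density z * z\<^sup>2) \<le> std_normal_density z * (z * (f' (m + s * z) - f' m))" for z
      \<comment> \<open>The lower bound on \<open>f''\<close> is global, so the radius may depend on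
        \<open>z\<close>; any value covering both points will do.\<close>
      using mult_left_mono[OF scaled_increment_ge[OF assms(1,2),
            where m = m and z = z and R = "\<bar>m + s * z\<bar> + \<bar>m\<bar>"], of "std_normal_density z"]
      by (simp add: mult_ac)
  qed (rule integrable_increment)
  ultimately show ?thesis unfolding grad_sigma_eq by simp
qed

text \<open>Only \<open>z \<in> [1/2, 1]\<close> is kept, where \<open>z\<^sup>2 \<ge> 1/4\<close> and the density is at least its value at 1.\<close>

lemma grad_sigma_ge_local:
  assumes c: "\<And>\<xi>. \<bar>\<xi>\<bar> \<le> R \<Longrightarrow> f'' \<xi> \<ge> c" "c \<ge> 0" and s: "s > 0" "\<bar>m\<bar> + s \<le> R"
  shows "grad_sigma m s \<ge> c * s * std_normal_density 1 / 8"
proof -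
  \<comment> \<open>The density is bounded by its value at 1 and \<open>c * s * z\<^sup>2\<close> by
    its value at 1/2. The interval has length 1/2, which turns the 4 into the final 8.\<close>
  define \<kappa> where "\<kappa> = std_normal_density 1 * (c * s / 4)"
  have "(\<integral>z. indicator {1/2..1::real} z * \<kappa> \<partial>lborel) = \<kappa> / 2"
    by simp
  moreover have "(\<integral>z. indicator {1/2..1::real} z * \<kappa> \<partial>lborel) \<le>
    (\<integral>z. std_normal_density z * (z * (f' (m + s * z) - f' m)) \<partial>lborel)"
  proof (rule integral_mono)
    show "indicator {1/2..1} z * \<kappa> \<le> std_normal_density z * (z * (f' (m + s * z) - f' m))" for z
    proof (cases "z \<in> {1/2..1}")
      case True
      then have "s * z \<le> s" "0 \<le> s * z" using s by (auto simp: mult_left_le)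
      then have "\<bar>m + s * z\<bar> \<le> R" "\<bar>m\<bar> \<le> R" using s by linarith+
      then have "z * (f' (m + s * z) - f' m) \<ge> c * s * z\<^sup>2"
        using s by (intro scaled_increment_ge[OF c(1)])
      moreover have "z\<^sup>2 \<ge> 1/4" using True power_mono[of "1/2" z 2] by (simp add: power2_eq_square)
      then have "c * s * z\<^sup>2 \<ge> c * s / 4" using c(2) s mult_left_mono[of "1/4" "z\<^sup>2" "c * s"] by simp
      ultimately have "z * (f' (m + s * z) - f' m) \<ge> c * s / 4" by simp
      moreover have "z\<^sup>2 \<le> 1" using True by (simp add: power_le_one)
      then have "std_normal_density z \<ge> std_normal_density 1"
        by (simp add: std_normal_density_def divide_right_mono)
      ultimately have "\<kappa> \<le> std_normal_density z * (z * (f' (m + s * z) - f' m))"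
        unfolding \<kappa>_def using c(2) s by (intro mult_mono) auto
      then show ?thesis using True by simp
    next
      case False
      then show ?thesis using scaled_increment_nonneg[OF s(1)] by simp
    qed
    show "integrable lborel (\<lambda>z::real. indicator {1/2..1::real} z * \<kappa>)"
      by (intro integrable_mult_left integrable_real_indicator emeasure_bounded_finite)
        simp_all
  qed (rule integrable_increment)
  ultimately show ?thesis unfolding grad_sigma_eq \<kappa>_def by (simp add: mult_ac)
qed

text \<open>The two integrals combine because (m - x0) + s z is the distance of m + s z from
  \<open>x0\<close>. Subtracting \<open>f' x0 = 0\<close> makes the integrand a product of
  increments, nonnegative by monotonicity of \<open>f'\<close>.\<close>

lemma grad_dissipative:
  assumes "f' x0 = 0"
  shows "(m - x0) * grad_mu m s + s * grad_sigma m s \<ge> 0"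
proof -
  have "(m - x0) * grad_mu m s + s * grad_sigma m s =
    (\<integral>z. (m - x0) * (std_normal_density z * f' (m + s * z)) +
      s * (std_normal_density z * (z * f' (m + s * z))) \<partial>lborel)"
    using integrable_affine_f'[of 1 0 m s] integrable_affine_f'[of 0 1 m s]
    by (subst Bochner_Integration.integral_add) simp_all
  also have "\<dots> = (\<integral>z. std_normal_density z * ((m + s * z - x0) * (f' (m + s * z) - f' x0)) \<partial>lborel)"
    by (rule Bochner_Integration.integral_cong) (simp_all add: assms algebra_simps)
  also have "\<dots> \<ge> 0" using increment_nonneg by simp
  finally show ?thesis .
qed

end

section \<open>Monotone quantities and decay along the flow\<close>

lemma nonincreasing_on_half_line:
  fixes u u' :: "real \<Rightarrow> real"
  assumes der: "\<And>t. t \<ge> 0 \<Longrightarrow> (u has_real_derivative u' t) (at t within {0..})"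
    and le: "\<And>t. t > 0 \<Longrightarrow> u' t \<le> 0"
    and "0 \<le> a" "a \<le> b"
  shows "u b \<le> u a"
proof (rule DERIV_nonpos_imp_decreasing_open[OF \<open>a \<le> b\<close>])
  fix t assume "a < t"
  then have "t > 0" using \<open>0 \<le> a\<close> by simp
  then have "(u has_real_derivative u' t) (at t)"
    using der[of t] at_within_interior[of t "{0..}"] by simp
  then show "\<exists>y. DERIV u t :> y \<and> y \<le> 0" using le[OF \<open>t > 0\<close>] by blast
next
  \<comment> \<open>The sign of \<open>u'\<close> is known only for positive times, so the endpoint
    0 enters through continuity alone. This covers a flow starting on the boundary
    \<open>\<sigma> 0 = 0\<close>.\<close>
  have "continuous_on {0..} u"
    using der by (intro DERIV_continuous_on[of "{0..}" u u']) auto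
  then show "continuous_on {a..b} u"
    using \<open>0 \<le> a\<close> by (auto elim: continuous_on_subset)
qed

locale convex_flow = convex_potential +
  fixes \<mu> \<sigma> :: "real \<Rightarrow> real"
  assumes flow: "gradient_flow f \<mu> \<sigma>"
begin

lemma sigma_nonneg: "t \<ge> 0 \<Longrightarrow> \<sigma> t \<ge> 0"
  using flow by (simp add: gradient_flow_def)

lemma mu_deriv:
  "t \<ge> 0 \<Longrightarrow> (\<mu> has_real_derivative - dF_mu f (\<mu> t) (\<sigma> t)) (at t within {0..})"
  using flow by (simp add: gradient_flow_def)

lemma sigma_deriv:
  "t \<ge> 0 \<Longrightarrow> (\<sigma> has_real_derivative - dF_sigma f (\<mu> t) (\<sigma> t)) (at t within {0..})"
  using flow by (simp add: gradient_flow_def)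

text \<open>At a positive time where \<open>\<sigma>\<close> vanishes it has an interior minimum, so the boundary value of
  the gradient is not needed.\<close>

lemma dF_sigma_zero:
  assumes "t > 0" "\<sigma> t = 0"
  shows "dF_sigma f (\<mu> t) (\<sigma> t) = 0"
proof -
  have "(\<sigma> has_real_derivative - dF_sigma f (\<mu> t) (\<sigma> t)) (at t)"
    using sigma_deriv[of t] assms at_within_interior[of t "{0..}"] by simp
  moreover have "\<forall>y. \<bar>t - y\<bar> < t \<longrightarrow> \<sigma> t \<le> \<sigma> y"
    using sigma_nonneg assms by auto
  ultimately have "- dF_sigma f (\<mu> t) (\<sigma> t) = 0"
    using DERIV_local_min[of \<sigma> _ t t] assms(1) by blast
  then show ?thesis by simp
qed

text \<open>This joins the interior estimate with the boundary case. Taking \<tau> = 0 gives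
  monotonicity of \<sigma>, and a positive \<tau> gives the exponential rate.\<close>

lemma dF_sigma_ge:
  assumes "t > 0" "\<tau> \<ge> 0" "\<And>x. f'' x \<ge> \<tau>"
  shows "dF_sigma f (\<mu> t) (\<sigma> t) \<ge> \<tau> * \<sigma> t"
proof (cases "\<sigma> t = 0")
  case True
  then show ?thesis using dF_sigma_zero assms by simp
next
  case False
  then have "\<sigma> t > 0" using sigma_nonneg[of t] assms(1) by simp
  then show ?thesis using grad_sigma_ge_uniform[OF assms(3)] by (simp add: dF_sigma_eq)
qed

lemma sigma_antimono: "0 \<le> a \<Longrightarrow> a \<le> b \<Longrightarrow> \<sigma> b \<le> \<sigma> a"
  using dF_sigma_ge[of _ 0] convex less_imp_le
  by (intro nonincreasing_on_half_line[OF sigma_deriv]) auto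

text \<open>A Gronwall argument: with the integrating factor \<open>exp (\<tau> * t)\<close>, the
  differential inequality says that the product is nonincreasing.\<close>

lemma sigma_exponential:
  assumes "\<tau> \<ge> 0" "\<And>x. f'' x \<ge> \<tau>" "t \<ge> 0"
  shows "\<sigma> t \<le> \<sigma> 0 * exp (- \<tau> * t)"
proof -
  have "\<sigma> t * exp (\<tau> * t) \<le> \<sigma> 0 * exp (\<tau> * 0)"
  proof (rule nonincreasing_on_half_line[where u = "\<lambda>t. \<sigma> t * exp (\<tau> * t)" and a = 0 and b = t])
    show "((\<lambda>t. \<sigma> t * exp (\<tau> * t)) has_real_derivative
        (\<tau> * \<sigma> t - dF_sigma f (\<mu> t) (\<sigma> t)) * exp (\<tau> * t)) (at t within {0..})" if "t \<ge> 0" for t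
      by (auto intro!: derivative_eq_intros sigma_deriv[OF that] simp: algebra_simps)
    show "(\<tau> * \<sigma> t - dF_sigma f (\<mu> t) (\<sigma> t)) * exp (\<tau> * t) \<le> 0" if "t > 0" for t
      using dF_sigma_ge[OF that assms(1,2)] by (simp add: mult_le_0_iff)
  qed (use assms in auto)
  then show ?thesis by (simp add: exp_minus field_simps)
qed

lemma sigma_not_bounded_below:
  assumes x0: "f' x0 = 0" and cont: "continuous_on UNIV f''" and L: "L > 0"
  shows "\<exists>t\<ge>0. \<sigma> t < L"
proof (rule ccontr)
  assume "\<not> ?thesis"
  then have ge: "\<sigma> t \<ge> L" if "t \<ge> 0" for t using that by force
  define W where "W = (\<lambda>t. (\<mu> t - x0)\<^sup>2 + (\<sigma> t)\<^sup>2)"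
  have W: "W t \<le> W 0" if "t \<ge> 0" for t
  proof (rule nonincreasing_on_half_line[where u = W and a = 0 and b = t])
    show "(W has_real_derivative
        - 2 * ((\<mu> t - x0) * dF_mu f (\<mu> t) (\<sigma> t) + \<sigma> t * dF_sigma f (\<mu> t) (\<sigma> t))) (at t within {0..})"
      if "t \<ge> 0" for t
      unfolding W_def
      by (auto intro!: derivative_eq_intros mu_deriv[OF that] sigma_deriv[OF that] simp: algebra_simps)
    \<comment> \<open>The assumption \<sigma> \<ge> L > 0 keeps the trajectory in the open half
      plane, where both gradient components are Gaussian integrals.\<close>
    show "- 2 * ((\<mu> t - x0) * dF_mu f (\<mu> t) (\<sigma> t) + \<sigma> t * dF_sigma f (\<mu> t) (\<sigma> t)) \<le> 0"
      if "t > 0" for t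
      using grad_dissipative[OF x0, of "\<mu> t" "\<sigma> t"] ge[of t] L that by (simp add: dF_mu_eq dF_sigma_eq)
  qed (use that in auto)
  \<comment> \<open>The first two terms bound \<open>\<bar>\<mu> t\<bar>\<close> through
    \<open>W\<close>, the last bounds \<open>\<sigma> t\<close> by monotonicity.\<close>
  define R where "R = \<bar>x0\<bar> + sqrt (W 0) + \<sigma> 0"
  have R: "\<bar>\<mu> t\<bar> + \<sigma> t \<le> R" if "t \<ge> 0" for t
  proof -
    have "(\<mu> t - x0)\<^sup>2 \<le> W 0" using W[OF that] unfolding W_def by (smt (verit) zero_le_power2)
    then have "\<bar>\<mu> t - x0\<bar> \<le> sqrt (W 0)" by (rule real_le_rsqrt[of "\<bar>\<mu> t - x0\<bar>", simplified])
    then show ?thesis using sigma_antimono[of 0 t] that by (simp add: R_def)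
  qed
  have "R \<ge> 0" using R[of 0] ge[of 0] L by simp
  \<comment> \<open>Continuity and compactness give a minimiser of \<open>f''\<close> on [-R, R], so
    the positive number \<open>f'' y\<close> is a uniform lower bound there.\<close>
  then obtain y where y: "\<And>x. \<bar>x\<bar> \<le> R \<Longrightarrow> f'' y \<le> f'' x"
    using continuous_attains_inf[of "{-R..R}" f''] continuous_on_subset[OF cont] by (force simp: abs_le_iff)
  define \<delta> where "\<delta> = f'' y * L * std_normal_density 1 / 8"
  have \<delta>: "\<delta> > 0" using convex L normal_density_pos[of 1 0 1] by (simp add: \<delta>_def)
  have lower: "dF_sigma f (\<mu> t) (\<sigma> t) \<ge> \<delta>" if "t > 0" for t
  proof -
    have "\<sigma> t > 0" "\<sigma> t \<ge> L" using ge[of t] L that by auto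
    then have "f'' y * \<sigma> t * std_normal_density 1 / 8 \<le> dF_sigma f (\<mu> t) (\<sigma> t)"
      using grad_sigma_ge_local[of R "f'' y", OF y less_imp_le[OF convex]] R[of t] that
      by (simp add: dF_sigma_eq)
    moreover have "\<delta> \<le> f'' y * \<sigma> t * std_normal_density 1 / 8"
      unfolding \<delta>_def using \<open>\<sigma> t \<ge> L\<close> convex[of y]
      by (intro divide_right_mono mult_right_mono mult_left_mono) auto
    ultimately show ?thesis by simp
  qed
  have "\<sigma> t + \<delta> * t \<le> \<sigma> 0 + \<delta> * 0" if "t \<ge> 0" for t
  proof (rule nonincreasing_on_half_line[where u = "\<lambda>t. \<sigma> t + \<delta> * t" and a = 0 and b = t])
    show "((\<lambda>t. \<sigma> t + \<delta> * t) has_real_derivative \<delta> - dF_sigma f (\<mu> t) (\<sigma> t)) (at t within {0..})"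
      if "t \<ge> 0" for t
      by (auto intro!: derivative_eq_intros sigma_deriv[OF that])
  qed (use lower that in auto)
  \<comment> \<open>At this time the linear upper bound \<open>\<sigma> 0 - \<delta> * t\<close>
    reaches 0, against \<sigma> \<ge> L > 0.\<close>
  from this[of "\<sigma> 0 / \<delta>"] show False
    using \<delta> ge[of "\<sigma> 0 / \<delta>"] ge[of 0] L by simp
qed

text \<open>Since \<sigma> is nonincreasing and nonnegative, a single time below \<open>e\<close>
  controls all later times.\<close>

lemma sigma_tendsto_zero:
  assumes "f' x0 = 0" "continuous_on UNIV f''"
  shows "(\<sigma> \<longlongrightarrow> 0) at_top"
proof (rule tendstoI)
  fix e :: real assume "e > 0"
  then obtain T where T: "T \<ge> 0" "\<sigma> T < e" using sigma_not_bounded_below[OF assms] by blast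
  show "eventually (\<lambda>t. dist (\<sigma> t) 0 < e) at_top"
    using eventually_ge_at_top[of T]
  proof eventually_elim
    case (elim t)
    then show ?case using sigma_antimono[of T t] sigma_nonneg[of t] T by simp
  qed
qed

end

theorem proposition2p10:
  fixes f \<mu> \<sigma> :: "real \<Rightarrow> real"
  assumes "Ckp 2 f"
    and "filterlim f at_top at_infinity"
    and "strictly_convex f"
    and "gradient_flow f \<mu> \<sigma>"
  shows "(\<sigma> \<longlongrightarrow> 0) at_top \<and>
         (uniformly_convex f \<longrightarrow> tends_to_zero_exponentially \<sigma>)"
proof -
  define f' where "f' = deriv f"
  define f'' where "f'' = deriv f'"
  have f'': "(deriv ^^ 2) f = f''" by (simp add: f''_def f'_def numeral_2_eq_2)
  have Ck: "Ck 2 f"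
    and lim: "\<And>j. j \<le> 2 \<Longrightarrow> \<exists>m. ((\<lambda>x. (deriv ^^ j) f x / \<bar>x\<bar> powr m) \<longlongrightarrow> 0) at_infinity"
    using assms(1) by (auto simp: Ckp_def)
  have cont: "continuous_on UNIV f" "continuous_on UNIV f'" "continuous_on UNIV f''"
    using Ck unfolding Ck_def f'_def f''[symmetric]
    by (metis funpow_0 zero_le, metis One_nat_def funpow_0 funpow_simps_right(2) o_apply one_le_numeral, blast)
  have "f differentiable (at x)" "f' differentiable (at x)" for x
    using Ck unfolding Ck_def f'_def
    by (metis funpow_0 zero_less_numeral, metis One_nat_def funpow_0 funpow_simps_right(2) o_apply one_less_numeral_iff semiring_norm(76))
  then have der: "(f has_real_derivative f' x) (at x)" "(f' has_real_derivative f'' x) (at x)" for x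
    unfolding f'_def f''_def by (simp_all add: DERIV_deriv_iff_real_differentiable)
  obtain C k where growth: "\<And>x. \<bar>f x\<bar> \<le> C * (1 + \<bar>x\<bar>) ^ k"
    using lim[of 0] continuous_imp_polynomial_growth[OF _ cont(1)] by (simp; blast)
  obtain C' k' where growth': "\<And>x. \<bar>f' x\<bar> \<le> C' * (1 + \<bar>x\<bar>) ^ k'"
    using lim[of 1] continuous_imp_polynomial_growth[OF _ cont(2)] unfolding f'_def
    by (simp; blast)
  interpret convex_flow f f' f'' C C' k k' \<mu> \<sigma>
    using der growth growth' assms(3,4) by unfold_locales (auto simp: strictly_convex_def f'')
  obtain x0 where x0: "f' x0 = 0" using exists_deriv_zero[OF assms(2) der(1)] by blast
  have "tends_to_zero_exponentially \<sigma>" if unif: "uniformly_convex f"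
  proof -
    obtain \<tau> where \<tau>: "\<tau> > 0" "\<And>x. f'' x \<ge> \<tau>"
      using unif by (auto simp: uniformly_convex_def f'')
    \<comment> \<open>The added 1 keeps the constant positive even when
      \<open>\<sigma> 0 = 0\<close>.\<close>
    have "\<bar>\<sigma> t\<bar> \<le> (\<sigma> 0 + 1) * exp (- \<tau> * t)" if "t \<ge> 0" for t
    proof -
      have "\<bar>\<sigma> t\<bar> \<le> \<sigma> 0 * exp (- \<tau> * t)"
        using sigma_exponential[of \<tau> t] sigma_nonneg[OF that] \<tau> that by simp
      also have "\<dots> \<le> (\<sigma> 0 + 1) * exp (- \<tau> * t)" by (intro mult_right_mono) auto
      finally show ?thesis .
    qed
    moreover have "\<sigma> 0 + 1 > 0" using sigma_nonneg[of 0] by simp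
    ultimately show ?thesis unfolding tends_to_zero_exponentially_def using \<tau>(1) by blast
  qed
  then show ?thesis using sigma_tendsto_zero[OF x0 cont(3)] by blast
qed

end
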